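(* Let $n$ be a positive integer and let $m := \frac{1}{2}n(n+1)$. Then there exists a real number $\Theta_n$ with $0 < \Theta_n < 1$ such that $$\sum_{k=1}^n \frac{1}{k} = \frac{1}{2}\ln(2m) + \gamma + \frac{1}{12m} - \frac{1}{120m^2} + \frac{1}{630m^3} - \frac{1}{1680m^4} + \frac{\Theta_n}{2310m^5}.$$
   Context: $\gamma = 0.57721\ldots$ denotes Euler's constant, and $\ln$ is the natural logarithm. *)

theory Defs
  imports "HOL-Analysis.Analysis"
begin

end

theory Submission
  imports Defs "HOL-Real_Asymp.Real_Asymp"
begin

text \<open>
  Let \<open>L \<theta> x\<close> be the right-hand side, without \<open>\<gamma>\<close>, as a function of a real \<open>x\<close>, with
  \<open>\<theta>\<close> in place of the last coefficient. Since \<open>H\<^sub>n - \<gamma> - L \<theta> n\<close> tends to \<open>0\<close>, it suffices to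
  show that it is strictly decreasing for \<open>\<theta> = 0\<close> and strictly increasing for \<open>\<theta> = 1\<close>. This amounts to
  the sign of \<open>L \<theta> x - L \<theta> (x - 1) - 1 / x\<close> for \<open>x > 1\<close>, which also tends to \<open>0\<close> at infinity and whose
  derivative is a rational function of constant sign.
\<close>

definition ramanujan_approx :: "real \<Rightarrow> real \<Rightarrow> real" where
  "ramanujan_approx \<theta> x = (let m = x * (x + 1) / 2 in
     1 / 2 * ln (2 * m) + 1 / (12 * m) - 1 / (120 * m ^ 2) + 1 / (630 * m ^ 3)
       - 1 / (1680 * m ^ 4) + \<theta> / (2310 * m ^ 5))"

definition ramanujan_step :: "real \<Rightarrow> real \<Rightarrow> real" where
  "ramanujan_step \<theta> x = ramanujan_approx \<theta> x - ramanujan_approx \<theta> (x - 1) - 1 / x"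

text \<open>Stated for the shape \<open>c / f x ^ k\<close>, so that it resolves directly against
  each summand of the expansion and yields a single fraction.\<close>

lemma has_derivative_inverse_power:
  fixes f :: "real \<Rightarrow> real"
  assumes "(f has_real_derivative f') (at x)" and "f x \<noteq> 0"
  shows "((\<lambda>x. c / f x ^ k) has_real_derivative - real k * c * f' / f x ^ Suc k) (at x)"
proof -
  have "((\<lambda>y. c / y ^ k) has_real_derivative - real k * c / y ^ Suc k) (at y)" if "y \<noteq> 0" for y :: real
  proof (cases k)
    case (Suc j)
    have "((\<lambda>y. c * inverse (y ^ Suc j)) has_real_derivative
        c * - (inverse (y ^ Suc j) * (real (Suc j) * y ^ j) * inverse (y ^ Suc j))) (at y)"
      using that DERIV_pow[of "Suc j" y UNIV] by (intro DERIV_cmult DERIV_inverse') auto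
    then show ?thesis
      unfolding Suc divide_inverse by (rule DERIV_cong) (use that in \<open>simp add: field_simps\<close>)
  qed simp
  from DERIV_chain2[OF this assms(1)] assms(2) show ?thesis by simp
qed

lemma has_derivative_ramanujan_approx:
  assumes "x > 0"
  shows "(ramanujan_approx \<theta> has_real_derivative
    (2 * x + 1) * (1 / (2 * (x * (x + 1))) - 1 / (6 * (x * (x + 1)) ^ 2)
      + 1 / (15 * (x * (x + 1)) ^ 3) - 4 / (105 * (x * (x + 1)) ^ 4)
      + 4 / (105 * (x * (x + 1)) ^ 5) - 16 * \<theta> / (231 * (x * (x + 1)) ^ 6))) (at x)"
proof -
  \<comment> \<open>The approximation depends on \<open>x\<close> only through
    \<open>p = x * (x + 1) = 2 * m\<close>; substituting \<open>m = p / 2\<close> multiplies the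
    coefficient of \<open>1 / m ^ k\<close> by \<open>2 ^ k\<close>.\<close>
  define f where "f = (\<lambda>p. 1 / 2 * ln p + (1 / 6) / p ^ 1 - (1 / 30) / p ^ 2 + (4 / 315) / p ^ 3
    - (1 / 105) / p ^ 4 + (16 * \<theta> / 1155) / p ^ 5)"
  have eq: "ramanujan_approx \<theta> = (\<lambda>x. f (x * (x + 1)))"
    by (rule ext) (simp add: ramanujan_approx_def f_def Let_def power_divide)
  have f: "(f has_real_derivative
      1 / (2 * p) - 1 / (6 * p ^ 2) + 1 / (15 * p ^ 3) - 4 / (105 * p ^ 4)
        + 4 / (105 * p ^ 5) - 16 * \<theta> / (231 * p ^ 6)) (at p)" if "p > 0" for p
  proof -
    have "p \<noteq> 0" using that by simp
    note inv = has_derivative_inverse_power[OF DERIV_ident this]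
    show ?thesis
      unfolding f_def
      by (rule DERIV_cong, (rule DERIV_add DERIV_diff DERIV_cmult DERIV_ln[OF that] inv)+)
        (simp add: inverse_eq_divide eval_nat_numeral)
  qed
  have g: "((\<lambda>x. x * (x + 1)) has_real_derivative 2 * x + 1) (at x)"
    by (auto intro!: derivative_eq_intros)
  show ?thesis
    unfolding eq using DERIV_chain2[OF f g] assms by (simp add: mult.commute)
qed

text \<open>The numerator is affine in \<open>\<theta>\<close>; splitting it into its values at 0
  and 1 lets the signs in these two cases be read off.\<close>

lemma has_derivative_ramanujan_step:
  assumes "x > 1"
  shows "(ramanujan_step \<theta> has_real_derivative
    ((1 - \<theta>) * (- 704 * x ^ 2 * (x ^ 2 - 1) * (5 * x ^ 2 - 1))
      + \<theta> * (64 * (191 * x ^ 4 - 26 * x ^ 2 - 5))) / (2310 * (x ^ 6 * (x + 1) ^ 6 * (x - 1) ^ 6))) (at x)"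
proof -
  define G where "G p = 1 / (2 * p) - 1 / (6 * p ^ 2) + 1 / (15 * p ^ 3) - 4 / (105 * p ^ 4)
    + 4 / (105 * p ^ 5) - 16 * \<theta> / (231 * p ^ 6)" for p
  define N where "N p = 1155 * p ^ 5 - 385 * p ^ 4 + 154 * p ^ 3 - 88 * p ^ 2 + 88 * p - 160 * \<theta>" for p
  have GN: "G p = N p / (2310 * p ^ 6)" if "p \<noteq> 0" for p
    using that by (simp add: G_def N_def add_divide_distrib diff_divide_distrib eval_nat_numeral)
  have approx: "(ramanujan_approx \<theta> has_real_derivative (2 * y + 1) * G (y * (y + 1))) (at y)"
    if "y > 0" for y
    unfolding G_def by (rule has_derivative_ramanujan_approx[OF that])
  have "((\<lambda>x. ramanujan_approx \<theta> (x - 1)) has_real_derivative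
      (2 * (x - 1) + 1) * G ((x - 1) * (x - 1 + 1)) * 1) (at x)"
    by (rule DERIV_chain2[OF approx]) (use assms in \<open>auto intro!: derivative_eq_intros\<close>)
  then have shift: "((\<lambda>x. ramanujan_approx \<theta> (x - 1)) has_real_derivative
      (2 * x - 1) * G (x * (x - 1))) (at x)"
    by (simp add: mult.commute)
  have inv: "((\<lambda>x. 1 / x) has_real_derivative - 1 / x ^ 2) (at x)"
    using assms by (auto intro!: derivative_eq_intros simp: power2_eq_square)
  \<comment> \<open>The sixth powers of \<open>x * (x + 1)\<close> and \<open>x * (x - 1)\<close>
    share the factor \<open>x ^ 6\<close>, so this is a common denominator of all three
    terms.\<close>
  define D where "D = 2310 * (x ^ 6 * (x + 1) ^ 6 * (x - 1) ^ 6)"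
  have "G (x * (x + 1)) = N (x * (x + 1)) * (x - 1) ^ 6 / D"
    "G (x * (x - 1)) = N (x * (x - 1)) * (x + 1) ^ 6 / D"
    "1 / x ^ 2 = 2310 * (x ^ 4 * (x + 1) ^ 6 * (x - 1) ^ 6) / D"
    using assms by (simp_all add: GN D_def power_mult_distrib frac_eq_eq flip: power_add)
  then have "(2 * x + 1) * G (x * (x + 1)) - (2 * x - 1) * G (x * (x - 1)) - - 1 / x ^ 2
    = ((2 * x + 1) * (N (x * (x + 1)) * (x - 1) ^ 6) - (2 * x - 1) * (N (x * (x - 1)) * (x + 1) ^ 6)
       + 2310 * (x ^ 4 * (x + 1) ^ 6 * (x - 1) ^ 6)) / D"
    by (simp add: add_divide_distrib diff_divide_distrib)
  \<comment> \<open>The coefficients of the expansion make all powers above \<open>x ^ 6\<close>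
    cancel, and for \<open>\<theta> = 1\<close> also \<open>x ^ 6\<close> itself.\<close>
  also have "(2 * x + 1) * (N (x * (x + 1)) * (x - 1) ^ 6) - (2 * x - 1) * (N (x * (x - 1)) * (x + 1) ^ 6)
       + 2310 * (x ^ 4 * (x + 1) ^ 6 * (x - 1) ^ 6)
    = (1 - \<theta>) * (- 704 * x ^ 2 * (x ^ 2 - 1) * (5 * x ^ 2 - 1))
      + \<theta> * (64 * (191 * x ^ 4 - 26 * x ^ 2 - 5))"
    unfolding N_def by algebra
  finally show ?thesis
    unfolding ramanujan_step_def[abs_def] D_def
    using DERIV_diff[OF DERIV_diff[OF approx shift] inv] assms by simp
qed

lemma tendsto_ramanujan_step: "(ramanujan_step \<theta> \<longlongrightarrow> 0) at_top"
  unfolding ramanujan_step_def[abs_def] ramanujan_approx_def Let_def by real_asymp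

lemma ramanujan_step_pos:
  assumes "x > 1"
  shows "ramanujan_step 0 x > 0"
proof (rule DERIV_neg_imp_decreasing_at_top[OF _ tendsto_ramanujan_step])
  fix y assume "y \<ge> x"
  with assms have y: "y > 1" by simp
  have "y ^ 2 > 1" "5 * y ^ 2 > 1" using one_less_power[OF y, of 2] by auto
  then show "\<exists>D. (ramanujan_step 0 has_real_derivative D) (at y) \<and> D < 0"
    using y by - (rule exI, rule conjI, erule has_derivative_ramanujan_step,
      auto intro!: divide_pos_pos mult_pos_pos)
qed

lemma ramanujan_step_neg:
  assumes "x > 1"
  shows "ramanujan_step 1 x < 0"
proof -
  \<comment> \<open>Negation turns the increasing function into a decreasing one with limit 0, as
    the rule requires.\<close>
  have "- 0 < - ramanujan_step 1 x"
  proof (rule DERIV_neg_imp_decreasing_at_top[OF _ tendsto_minus[OF tendsto_ramanujan_step]])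
    fix y assume "y \<ge> x"
    with assms have y: "y > 1" by simp
    have y2: "y ^ 2 > 1" using y by simp
    \<comment> \<open>From \<open>y ^ 4 > y ^ 2 > 1\<close> the numerator factor exceeds
      \<open>165 * y ^ 2 - 5 > 0\<close>.\<close>
    have "y ^ 4 = y ^ 2 * y ^ 2" by (simp flip: power_add)
    moreover have "y ^ 2 * 1 < y ^ 2 * y ^ 2" using y2 by (intro mult_strict_left_mono) auto
    ultimately have "191 * y ^ 4 - 26 * y ^ 2 - 5 > 0" using y2 by linarith
    then show "\<exists>D. ((\<lambda>x. - ramanujan_step 1 x) has_real_derivative D) (at y) \<and> D < 0"
      using y by - (rule exI, rule conjI, rule DERIV_minus, erule has_derivative_ramanujan_step,
        auto intro!: divide_pos_pos mult_pos_pos)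
  qed
  then show ?thesis by simp
qed

lemma harm_minus_ramanujan_approx_Suc:
  "harm (Suc n) - ramanujan_approx \<theta> (Suc n)
    = harm n - ramanujan_approx \<theta> n - ramanujan_step \<theta> (Suc n)"
  by (simp add: harm_Suc ramanujan_step_def divide_inverse)

text \<open>The logarithmic part differs from \<open>ln n\<close> by
  \<open>ln (1 + 1 / n) / 2\<close>, and the remaining terms vanish in the limit.\<close>

lemma tendsto_harm_minus_ramanujan_approx:
  "(\<lambda>n. harm n - ramanujan_approx \<theta> n) \<longlonglongrightarrow> euler_mascheroni"
proof -
  have "(\<lambda>n::nat. ln (real n) - ramanujan_approx \<theta> n) \<longlonglongrightarrow> 0"
    unfolding ramanujan_approx_def Let_def by real_asymp
  from tendsto_add[OF euler_mascheroni_LIMSEQ this] show ?thesis by simp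
qed

lemma strict_decreasing_tendsto_less:
  fixes f :: "nat \<Rightarrow> real"
  assumes "f \<longlonglongrightarrow> l" and "\<And>k. k \<ge> n \<Longrightarrow> f (Suc k) < f k"
  shows "l < f n"
proof -
  \<comment> \<open>Limits preserve only weak inequalities, so the comparison is with
    \<open>f (Suc n)\<close>; the step from \<open>n\<close> to \<open>Suc n\<close> supplies
    strictness.\<close>
  have "f k \<le> f (Suc n)" if "k \<ge> Suc n" for k
    using that
  proof (induction k rule: dec_induct)
    case (step k)
    then show ?case using assms(2)[of k] by simp
  qed simp
  then have "l \<le> f (Suc n)"
    by (intro LIMSEQ_le_const2[OF assms(1)]) blast
  with assms(2)[of n] show ?thesis by simp
qed

theorem theorem1:
  fixes n :: nat and m :: real
  assumes "n > 0"
    and "m = 1 / 2 * real n * (real n + 1)"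
  shows "\<exists>\<Theta>::real. 0 < \<Theta> \<and> \<Theta> < 1 \<and>
    (\<Sum>k = 1..n. 1 / real k) =
      1 / 2 * ln (2 * m) + euler_mascheroni + 1 / (12 * m) - 1 / (120 * m ^ 2)
        + 1 / (630 * m ^ 3) - 1 / (1680 * m ^ 4) + \<Theta> / (2310 * m ^ 5)"
proof -
  define e where "e \<theta> k = harm k - ramanujan_approx \<theta> (real k)" for \<theta> and k :: nat
  have lim: "e \<theta> \<longlonglongrightarrow> euler_mascheroni" for \<theta>
    unfolding e_def by (rule tendsto_harm_minus_ramanujan_approx)
  have suc: "e \<theta> (Suc k) = e \<theta> k - ramanujan_step \<theta> (Suc k)" for \<theta> k
    unfolding e_def by (rule harm_minus_ramanujan_approx_Suc)
  \<comment> \<open>Positivity of \<open>n\<close> gives \<open>Suc k > 1\<close> for all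
    \<open>k \<ge> n\<close>, the range where the sign of the step is known.\<close>
  have lower: "euler_mascheroni < e 0 n"
    using assms(1) by (intro strict_decreasing_tendsto_less[OF lim]) (simp add: suc ramanujan_step_pos)
  have "- euler_mascheroni < - e 1 n"
    using assms(1) by (intro strict_decreasing_tendsto_less[OF tendsto_minus[OF lim]])
      (simp add: suc ramanujan_step_neg)
  then have upper: "e 1 n < euler_mascheroni" by simp
  have m: "m > 0" unfolding assms(2) using assms(1) by simp
  have approx: "ramanujan_approx \<theta> n = 1 / 2 * ln (2 * m) + 1 / (12 * m) - 1 / (120 * m ^ 2)
      + 1 / (630 * m ^ 3) - 1 / (1680 * m ^ 4) + \<theta> / (2310 * m ^ 5)" for \<theta>
    unfolding ramanujan_approx_def Let_def assms(2) by simp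
  have harm: "harm n = (\<Sum>k = 1..n. 1 / real k)"
    by (simp add: harm_def divide_inverse)
  \<comment> \<open>This solves the claimed equation for \<open>\<Theta>\<close>. The bound
    \<open>lower\<close> gives \<open>\<Theta> > 0\<close>, and \<open>upper\<close> gives
    \<open>\<Theta> < 1\<close>, since the approximations for 1 and 0 differ by
    \<open>1 / (2310 * m ^ 5)\<close>.\<close>
  define \<Theta> where "\<Theta> = (e 0 n - euler_mascheroni) * (2310 * m ^ 5)"
  have \<Theta>: "\<Theta> / (2310 * m ^ 5) = e 0 n - euler_mascheroni"
    using m by (simp add: \<Theta>_def)
  have "\<Theta> / (2310 * m ^ 5) < 1 / (2310 * m ^ 5)"
    using upper approx[of 0] approx[of 1] unfolding \<Theta> e_def by simp
  then have "\<Theta> < 1" using m by (simp add: divide_less_cancel)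
  moreover have "\<Theta> > 0" using lower m by (simp add: \<Theta>_def)
  moreover have "harm n = ramanujan_approx \<Theta> n + euler_mascheroni"
    using approx[of 0] approx[of \<Theta>] \<Theta> unfolding e_def by simp
  ultimately show ?thesis
    using approx[of \<Theta>] unfolding harm by (intro exI[of _ \<Theta>]) simp
qed

end
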